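(* Let $R$ be a commutative ring with unity, let $(G,\alpha)$ be an edge-labeled graph over $R$, and let $(G',\alpha')$ be an edge-labeled subgraph of $(G,\alpha)$ such that for any $u,v\in V(G')$ we have $\mathcal{P}_{G'}(u,v)=\mathcal{P}_G(u,v)$. If $(G,\alpha)$ satisfies the Universal Difference Property, then $(G',\alpha')$ satisfies the Universal Difference Property.
   Context: All graphs are connected and all rings are commutative with unity. An edge-labeling of a graph $G$ over $R$ is a function $\alpha$ from $E(G)$ to the set of ideals of $R$. An edge-labeled subgraph $(H,\alpha')$ of $(G,\alpha)$ consists of a subgraph $H$ of $G$ with $\alpha'(e)=\alpha(e)$ for all $e\in E(H)$. A (generalized) spline on $(G,\alpha)$ is a function $\rho:V(G)\to R$ such that $\rho(u)-\rho(v)\in\alpha(uv)$ for every edge $uv$. A path has no repeated vertices; $\mathcal{P}_G(u,v)$ denotes the set of all paths in $G$ from $u$ to $v$, and for a path $P$, $\alpha(P)$ is the sum of the ideals labeling the edges of $P$. $(G,\alpha)$ satisfies the Universal Difference Property (UDP) if for every pair of vertices $u,w$ and every $x\in\bigcap_{P\in\mathcal{P}_G(u,w)}\alpha(P)$ there exists a spline $\rho$ on $(G,\alpha)$ with $\rho(u)-\rho(w)=x$. *)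

theory Defs
  imports "HOL-Algebra.Ideal"
begin

text \<open>A graph is given by a vertex set and a set of two-element subsets of it. Graphs may be
  infinite.\<close>

definition simple_graph :: "'v set \<Rightarrow> 'v set set \<Rightarrow> bool" where
  "simple_graph V E \<longleftrightarrow>
    V \<noteq> {} \<and> (\<forall>e\<in>E. \<exists>u v. u \<in> V \<and> v \<in> V \<and> u \<noteq> v \<and> e = {u, v})"

fun path_edges :: "'v list \<Rightarrow> 'v set list" where
  "path_edges [] = []"
| "path_edges [x] = []"
| "path_edges (x # y # xs) = {x, y} # path_edges (y # xs)"

text \<open>A path is the list of its vertices, which determines it as there are no multiple edges. The
  one-vertex list is the trivial path from a vertex to itself.\<close>

definition paths :: "'v set \<Rightarrow> 'v set set \<Rightarrow> 'v \<Rightarrow> 'v \<Rightarrow> 'v list set" where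
  "paths V E u v =
    {p. p \<noteq> [] \<and> hd p = u \<and> last p = v \<and> distinct p \<and> set p \<subseteq> V \<and> set (path_edges p) \<subseteq> E}"

definition connected_graph :: "'v set \<Rightarrow> 'v set set \<Rightarrow> bool" where
  "connected_graph V E \<longleftrightarrow> simple_graph V E \<and> (\<forall>u\<in>V. \<forall>v\<in>V. paths V E u v \<noteq> {})"

text \<open>Only the values of an edge-labeling on the edge set are relevant.\<close>

definition edge_labeling ::
    "('r, 'm) ring_scheme \<Rightarrow> 'v set set \<Rightarrow> ('v set \<Rightarrow> 'r set) \<Rightarrow> bool" where
  "edge_labeling R E \<alpha> \<longleftrightarrow> (\<forall>e\<in>E. ideal (\<alpha> e) R)"

definition edge_labeled_graph ::
    "('r, 'm) ring_scheme \<Rightarrow> 'v set \<Rightarrow> 'v set set \<Rightarrow> ('v set \<Rightarrow> 'r set) \<Rightarrow> bool" where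
  "edge_labeled_graph R V E \<alpha> \<longleftrightarrow> connected_graph V E \<and> edge_labeling R E \<alpha>"

definition edge_labeled_subgraph ::
    "('r, 'm) ring_scheme \<Rightarrow> 'v set \<Rightarrow> 'v set set \<Rightarrow> ('v set \<Rightarrow> 'r set) \<Rightarrow>
      'v set \<Rightarrow> 'v set set \<Rightarrow> ('v set \<Rightarrow> 'r set) \<Rightarrow> bool" where
  "edge_labeled_subgraph R V' E' \<alpha>' V E \<alpha> \<longleftrightarrow>
    edge_labeled_graph R V' E' \<alpha>' \<and> V' \<subseteq> V \<and> E' \<subseteq> E \<and> (\<forall>e\<in>E'. \<alpha>' e = \<alpha> e)"

definition spline ::
    "('r, 'm) ring_scheme \<Rightarrow> 'v set \<Rightarrow> 'v set set \<Rightarrow> ('v set \<Rightarrow> 'r set) \<Rightarrow> ('v \<Rightarrow> 'r) \<Rightarrow> bool" where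
  "spline R V E \<alpha> \<rho> \<longleftrightarrow>
    \<rho> \<in> V \<rightarrow> carrier R \<and> (\<forall>u v. {u, v} \<in> E \<longrightarrow> \<rho> u \<ominus>\<^bsub>R\<^esub> \<rho> v \<in> \<alpha> {u, v})"

text \<open>The sum of the ideals along a path; the empty sum is the zero ideal.\<close>

definition path_label ::
    "('r, 'm) ring_scheme \<Rightarrow> ('v set \<Rightarrow> 'r set) \<Rightarrow> 'v list \<Rightarrow> 'r set" where
  "path_label R \<alpha> p = foldr (\<lambda>I J. I <+>\<^bsub>R\<^esub> J) (map \<alpha> (path_edges p)) {\<zero>\<^bsub>R\<^esub>}"

text \<open>In a connected graph the intersection below is over a nonempty family.\<close>

definition UDP ::
    "('r, 'm) ring_scheme \<Rightarrow> 'v set \<Rightarrow> 'v set set \<Rightarrow> ('v set \<Rightarrow> 'r set) \<Rightarrow> bool" where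
  "UDP R V E \<alpha> \<longleftrightarrow>
    (\<forall>u\<in>V. \<forall>w\<in>V. \<forall>x \<in> (\<Inter>p\<in>paths V E u w. path_label R \<alpha> p).
      \<exists>\<rho>. spline R V E \<alpha> \<rho> \<and> \<rho> u \<ominus>\<^bsub>R\<^esub> \<rho> w = x)"

end

theory Submission
  imports Defs
begin

text \<open>A spline on the large graph is also one on the subgraph, because the subgraph imposes
  only some of the edge conditions, with the same ideals (\<open>spline_subgraph\<close>). For two
  vertices of the subgraph the path sets coincide, and so do the path labels
  (\<open>path_label_cong\<close>), so both graphs have the same intersection of path labels. An
  element of it is realized as a difference by the UDP of the large graph, and the same spline
  serves the subgraph.\<close>

text \<open>Needed because \<open>\<alpha>\<close> and \<open>\<alpha>'\<close> may differ outside
  \<open>E'\<close>.\<close>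

lemma path_label_cong:
  assumes "\<And>e. e \<in> set (path_edges p) \<Longrightarrow> \<alpha> e = \<beta> e"
  shows "path_label R \<alpha> p = path_label R \<beta> p"
proof -
  have "map \<alpha> (path_edges p) = map \<beta> (path_edges p)"
    using assms by simp
  then show ?thesis
    unfolding path_label_def by (rule arg_cong)
qed

lemma spline_subgraph:
  assumes "spline R V E \<alpha> \<rho>" "V' \<subseteq> V" "E' \<subseteq> E" "\<forall>e\<in>E'. \<alpha>' e = \<alpha> e"
  shows "spline R V' E' \<alpha>' \<rho>"
  using assms unfolding spline_def by (auto simp: Pi_iff)

theorem theorem2p5:
  fixes R :: "('r, 'm) ring_scheme"
    and V V' :: "'v set" and E E' :: "'v set set"
    and \<alpha> \<alpha>' :: "'v set \<Rightarrow> 'r set"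
  assumes "cring R"
    and "edge_labeled_graph R V E \<alpha>"
    and "edge_labeled_subgraph R V' E' \<alpha>' V E \<alpha>"
    and "\<forall>u\<in>V'. \<forall>v\<in>V'. paths V' E' u v = paths V E u v"
    and "UDP R V E \<alpha>"
  shows "UDP R V' E' \<alpha>'"
  unfolding UDP_def
proof (intro ballI)
  fix u w x
  assume u: "u \<in> V'" and w: "w \<in> V'"
    and x: "x \<in> (\<Inter>p\<in>paths V' E' u w. path_label R \<alpha>' p)"
  have sub: "V' \<subseteq> V" "E' \<subseteq> E" "\<forall>e\<in>E'. \<alpha>' e = \<alpha> e"
    using assms(3) unfolding edge_labeled_subgraph_def by auto
  \<comment> \<open>Taking \<open>p\<close> in the subgraph puts its edges in \<open>E'\<close>,
    where the labelings agree.\<close>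
  have "path_label R \<alpha>' p = path_label R \<alpha> p" if "p \<in> paths V' E' u w" for p
    using that sub(3) by (intro path_label_cong) (auto simp: paths_def)
  moreover have "paths V' E' u w = paths V E u w"
    using assms(4) u w by blast
  ultimately have "x \<in> (\<Inter>p\<in>paths V E u w. path_label R \<alpha> p)"
    using x by auto
  moreover have "u \<in> V" "w \<in> V"
    using u w sub(1) by auto
  ultimately obtain \<rho> where "spline R V E \<alpha> \<rho>" "\<rho> u \<ominus>\<^bsub>R\<^esub> \<rho> w = x"
    using assms(5) unfolding UDP_def by blast
  \<comment> \<open>The witness is \<open>\<rho>\<close> itself: as a total function it is used
    without restricting it to \<open>V'\<close>.\<close>
  then show "\<exists>\<rho>. spline R V' E' \<alpha>' \<rho> \<and> \<rho> u \<ominus>\<^bsub>R\<^esub> \<rho> w = x"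
    using spline_subgraph[OF _ sub] by blast
qed

end
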